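(* For every $k\ge 3$, every $q\ge 1$ and every $n\ge k$, $$N_k(q,n)\le q^{V_{k-1}(q,n+k-2)}+k-2.$$
   Context: For $k\ge 1$, a monotone (tight) path of length $n$ in the complete $k$-uniform hypergraph on $[N]$ is given by $j_1<\dots<j_n$ in $[N]$ with the $k$-sets $\{j_i,\dots,j_{i+k-1}\}$, $i=1,\dots,n-k+1$; $N_k(q,n)$ is the smallest $N$ such that every $q$-coloring of the $k$-subsets of $[N]$ contains a monochromatic monotone path of length $n$. The vertex online Ramsey number $V_k(q,n)$ is defined by the following game between builder and painter. At the start of stage $t\ge 1$ a new vertex $v_t$ is added (vertices are ordered by index); for each $(k-1)$-tuple $v_{i_1},\dots,v_{i_{k-1}}$ with $i_1<\dots<i_{k-1}<t$, builder decides (in any order) whether to draw the edge $\{v_{i_1},\dots,v_{i_{k-1}},v_t\}$, and each drawn edge is immediately colored by painter with one of $q$ colors. A monochromatic monotone path of length $n$ is a sequence $v_{a_1},\dots,v_{a_n}$ with $a_1<\dots<a_n$ such that all $k$-sets $\{v_{a_i},\dots,v_{a_{i+k-1}}\}$ ($1\le i\le n-k+1$) are drawn edges of one color. $V_k(q,n)$ is the minimum number of edges builder must draw to guarantee a monochromatic monotone path of length $n$, against any painter strategy.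
   Formalization: The formal statement assumes q ≥ 2 instead of q ≥ 1: for q = 1 the claim is false for all k ≥ 3, n ≥ k, since N_k(1,n) = n ≥ k while the right-hand side equals 1 + k − 2 = k − 1. *)

theory Defs
  imports "HOL-Library.Ramsey"
begin

text \<open>For \<open>n < k\<close> the index range \<open>{1..n + 1 - k}\<close> is empty, for \<open>n \<ge> k\<close> it is
  \<open>1, \<dots>, n - k + 1\<close>.  The length \<open>n\<close> counts vertices.\<close>

definition monotone_path ::
    "nat \<Rightarrow> nat \<Rightarrow> nat set \<Rightarrow> nat set set \<Rightarrow> (nat \<Rightarrow> nat) \<Rightarrow> bool" where
  "monotone_path k n V E a \<longleftrightarrow>
     a ` {1..n} \<subseteq> V \<and> strict_mono_on {1..n} a \<and> (\<forall>i\<in>{1..n + 1 - k}. a ` {i..<i + k} \<in> E)"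

definition path_ramsey :: "nat \<Rightarrow> nat \<Rightarrow> nat \<Rightarrow> nat" where
  "path_ramsey k q n =
     (LEAST N. \<forall>\<chi> \<in> nsets {1..N} k \<rightarrow> {..<q}.
        \<exists>c<q. \<exists>a. monotone_path k n {1..N} {e \<in> nsets {1..N} k. \<chi> e = c} a)"

text \<open>Vertex \<open>v\<^sub>t\<close> is represented by its index \<open>t\<close>.  A history lists the events so far, most
  recent first; each \<open>Vertex_Added\<close> opens a new stage, so the number of these events is the number
  of the current stage as well as the index of the newest vertex.\<close>

datatype event = Vertex_Added | Edge_Colored "nat set" nat

datatype builder_move = Next_Stage | Draw "nat set"

type_synonym history = "event list"
type_synonym builder = "history \<Rightarrow> builder_move"
type_synonym painter = "history \<Rightarrow> nat set \<Rightarrow> nat"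

definition stage :: "history \<Rightarrow> nat" where
  "stage h = count_list h Vertex_Added"

definition edges_of_color :: "history \<Rightarrow> nat \<Rightarrow> nat set set" where
  "edges_of_color h c = {e. Edge_Colored e c \<in> set h}"

definition drawn_edges :: "history \<Rightarrow> nat set set" where
  "drawn_edges h = (\<Union>c. edges_of_color h c)"

definition legal_builder :: "nat \<Rightarrow> builder \<Rightarrow> bool" where
  "legal_builder k B \<longleftrightarrow>
     (\<forall>h e. B h = Draw e \<longrightarrow> e \<in> nsets {1..stage h} k \<and> stage h \<in> e \<and> e \<notin> drawn_edges h)"

definition legal_painter :: "nat \<Rightarrow> painter \<Rightarrow> bool" where
  "legal_painter q P \<longleftrightarrow> (\<forall>h e. P h e < q)"

primrec play :: "builder \<Rightarrow> painter \<Rightarrow> nat \<Rightarrow> history" where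
  "play B P 0 = [Vertex_Added]"
| "play B P (Suc i) =
     (let h = play B P i in
      case B h of
        Next_Stage \<Rightarrow> Vertex_Added # h
      | Draw e \<Rightarrow> Edge_Colored e (P h e) # h)"

definition has_mono_path :: "nat \<Rightarrow> nat \<Rightarrow> nat \<Rightarrow> history \<Rightarrow> bool" where
  "has_mono_path k q n h \<longleftrightarrow>
     (\<exists>c<q. \<exists>a. monotone_path k n {1..stage h} (edges_of_color h c) a)"

definition builder_wins_within :: "nat \<Rightarrow> nat \<Rightarrow> nat \<Rightarrow> nat \<Rightarrow> bool" where
  "builder_wins_within k q n m \<longleftrightarrow>
     (\<exists>B. legal_builder k B \<and>
        (\<forall>P. legal_painter q P \<longrightarrow>
           (\<exists>i. has_mono_path k q n (play B P i) \<and> card (drawn_edges (play B P i)) \<le> m)))"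

definition vertex_online_ramsey :: "nat \<Rightarrow> nat \<Rightarrow> nat \<Rightarrow> nat" where
  "vertex_online_ramsey k q n = (LEAST m. builder_wins_within k q n m)"

text \<open>With a single color the path Ramsey number is \<open>n\<close>, so a bound of the form
  \<open>q ^ x + (k - 2)\<close> fails for \<open>q = 1\<close> and every \<open>n \<ge> k\<close>, whatever the exponent is.\<close>

lemma path_ramsey_one_color:
  assumes "k \<le> n"
  shows "path_ramsey k 1 n = n"
  unfolding path_ramsey_def
proof (rule Least_equality)
  show "\<forall>\<chi> \<in> nsets {1..n} k \<rightarrow> {..<1::nat}.
          \<exists>c<1. \<exists>a. monotone_path k n {1..n} {e \<in> nsets {1..n} k. \<chi> e = c} a"
  proof
    fix \<chi> :: "nat set \<Rightarrow> nat"
    assume chi: "\<chi> \<in> nsets {1..n} k \<rightarrow> {..<1::nat}"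
    have win: "{i..<i + k} \<in> nsets {1..n} k" if "i \<in> {1..n + 1 - k}" for i
      using that assms by (auto simp: nsets_def)
    have "\<chi> {i..<i + k} = 0" if "i \<in> {1..n + 1 - k}" for i
      using funcset_mem[OF chi win[OF that]] by simp
    with win have "monotone_path k n {1..n} {e \<in> nsets {1..n} k. \<chi> e = 0} (\<lambda>i. i)"
      by (simp add: monotone_path_def strict_mono_on_def)
    then show "\<exists>c<1. \<exists>a. monotone_path k n {1..n} {e \<in> nsets {1..n} k. \<chi> e = c} a"
      by (metis less_numeral_extra(1))
  qed
next
  fix N
  assume "\<forall>\<chi> \<in> nsets {1..N} k \<rightarrow> {..<1::nat}.
            \<exists>c<1. \<exists>a. monotone_path k n {1..N} {e \<in> nsets {1..N} k. \<chi> e = c} a"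
  from bspec[OF this, of "\<lambda>_. 0"]
  obtain a where a: "a ` {1..n} \<subseteq> {1..N}" "strict_mono_on {1..n} a"
    by (auto simp: monotone_path_def)
  then have "card {1..n} \<le> card {1..N}"
    by (intro card_inj_on_le[of a]) (auto intro: strict_mono_on_imp_inj_on)
  then show "n \<le> N" by simp
qed

lemma no_bound_for_one_color:
  assumes "3 \<le> k" and "k \<le> n"
  shows "\<not> path_ramsey k 1 n \<le> 1 ^ x + (k - 2)"
  using assms by (simp add: path_ramsey_one_color del: One_nat_def)

end

theory Submission imports Defs begin

text \<open>Given a coloring \<open>\<chi>\<close> of the \<open>k\<close>-subsets of \<open>[N]\<close>, the painter of the \<open>(k - 1)\<close>-uniform game
  embeds the vertices of the game into \<open>[N]\<close> as they come, keeping a reserve \<open>S\<close> of later elements.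
  On a drawn edge \<open>e\<close> with image \<open>f e\<close> she plays the most frequent value of \<open>\<chi> (f e \<union> {w})\<close> over
  \<open>w \<in> S\<close>, and shrinks \<open>S\<close> to the \<open>w\<close> that attain it.  A vertex is embedded (as the minimum of \<open>S\<close>)
  only when the first edge ending in it is drawn; as \<open>\<lceil>(q ^ r - 1) / q\<rceil> = q ^ (r - 1)\<close> for \<open>q \<ge> 2\<close>,
  the reserve keeps at least \<open>q ^ (V - m)\<close> elements after \<open>m\<close> edges.  All but the first \<open>k - 2\<close> vertices
  of a monochromatic path are last vertices of an edge, hence embedded, so a path on \<open>n + k - 2\<close>
  vertices yields a \<open>\<chi>\<close>-monochromatic path on \<open>n\<close> vertices.\<close>

section \<open>Plays of legal builders\<close>

lemma stage_simps [simp]: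
  "stage [] = 0"
  "stage (Vertex_Added # h) = Suc (stage h)"
  "stage (Edge_Colored e c # h) = stage h"
  by (auto simp: stage_def)

lemma drawn_edges_iff: "e \<in> drawn_edges h \<longleftrightarrow> (\<exists>c. Edge_Colored e c \<in> set h)"
  by (auto simp: drawn_edges_def edges_of_color_def)

lemma drawn_edges_simps [simp]:
  "drawn_edges [] = {}"
  "drawn_edges (Vertex_Added # h) = drawn_edges h"
  "drawn_edges (Edge_Colored e c # h) = insert e (drawn_edges h)"
  by (auto simp: drawn_edges_iff)

lemma finite_drawn_edges [simp]: "finite (drawn_edges h)"
proof (induction h)
  case (Cons x h)
  then show ?case by (cases x) auto
qed simp

text \<open>In a play these are the vertices that the painter has embedded, since a vertex is placed
  when the first edge ending in it is drawn.\<close>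

definition backed :: "history \<Rightarrow> nat set" where
  "backed h = Max ` drawn_edges h"

text \<open>The head of the history tells whether the newest vertex already has an edge. This lets
  \<open>settle\<close> decide from the head alone whether a vertex must be placed.\<close>

definition well_formed :: "nat \<Rightarrow> history \<Rightarrow> bool" where
  "well_formed k h \<longleftrightarrow>
     drawn_edges h \<subseteq> nsets {1..stage h} k \<and>
     (if hd h = Vertex_Added then drawn_edges h \<subseteq> nsets {1..<stage h} k else stage h \<in> backed h)"

lemma Max_edge: "e \<in> nsets {1..t} k \<Longrightarrow> t \<in> e \<Longrightarrow> Max e = t"
  by (rule Max_eqI) (auto simp: nsets_def)

lemma well_formed_play:
  assumes "legal_builder k B"
  shows "well_formed k (play B P i)"
proof (induction i)
  case 0
  show ?case by (simp add: well_formed_def)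
next
  case (Suc i)
  let ?h = "play B P i"
  show ?case
  proof (cases "B ?h")
    case Next_Stage
    have "drawn_edges ?h \<subseteq> nsets {1..<Suc (stage ?h)} k"
      using Suc by (simp add: well_formed_def atLeastLessThanSuc_atLeastAtMost)
    also have "\<dots> \<subseteq> nsets {1..Suc (stage ?h)} k"
      by (rule nsets_mono) auto
    finally show ?thesis
      using Suc Next_Stage
      by (simp add: well_formed_def atLeastLessThanSuc_atLeastAtMost)
  next
    case (Draw e)
    then have "e \<in> nsets {1..stage ?h} k" "stage ?h \<in> e"
      using assms by (auto simp: legal_builder_def)
    then show ?thesis
      using Suc Draw Max_edge[of e "stage ?h" k] by (auto simp: well_formed_def Let_def backed_def)
  qed
qed

section \<open>The builder wins\<close>

definition missing_edges :: "nat \<Rightarrow> history \<Rightarrow> nat set set" where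
  "missing_edges k h = {e \<in> nsets {1..stage h} k. stage h \<in> e} - drawn_edges h"

definition greedy_builder :: "nat \<Rightarrow> builder" where
  "greedy_builder k h =
     (if missing_edges k h = {} then Next_Stage else Draw (SOME e. e \<in> missing_edges k h))"

lemma greedy_builder_Draw: "greedy_builder k h = Draw e \<Longrightarrow> e \<in> missing_edges k h"
  by (auto simp: greedy_builder_def some_in_eq split: if_splits)

lemma legal_greedy_builder: "legal_builder k (greedy_builder k)"
  using greedy_builder_Draw by (fastforce simp: legal_builder_def missing_edges_def)

text \<open>Each draw lowers the number of missing edges, so the stage is complete after finitely
  many moves.\<close>

lemma greedy_builder_completes_stage:
  "\<exists>j. stage (play (greedy_builder k) P j) = stage (play (greedy_builder k) P i) \<and>
       drawn_edges (play (greedy_builder k) P i) \<subseteq> drawn_edges (play (greedy_builder k) P j) \<and>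
       missing_edges k (play (greedy_builder k) P j) = {}"
proof (induction "card (missing_edges k (play (greedy_builder k) P i))" arbitrary: i
    rule: less_induct)
  case less
  let ?h = "play (greedy_builder k) P i" and ?h' = "play (greedy_builder k) P (Suc i)"
  show ?case
  proof (cases "missing_edges k ?h = {}")
    case True
    then show ?thesis by blast
  next
    case False
    then obtain e where e: "greedy_builder k ?h = Draw e"
      by (simp add: greedy_builder_def)
    then have h': "?h' = Edge_Colored e (P ?h e) # ?h"
      by (simp add: Let_def)
    have "missing_edges k ?h' = missing_edges k ?h - {e}"
      unfolding h' by (auto simp: missing_edges_def)
    moreover have "finite (missing_edges k ?h)"
      by (simp add: missing_edges_def finite_imp_finite_nsets)
    ultimately have "card (missing_edges k ?h') < card (missing_edges k ?h)"
      using greedy_builder_Draw[OF e] by (simp only: card_Diff1_less)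
    from less[OF this] show ?thesis
      unfolding h' by (auto simp del: play.simps)
  qed
qed

text \<open>For \<open>k = 0\<close> the empty edge contains no vertex and is never drawn;
  \<open>nsets {} k\<close> accounts for it and is empty for positive \<open>k\<close>.\<close>

lemma greedy_builder_completes_graph:
  "\<exists>i. stage (play (greedy_builder k) P i) = Suc M \<and>
       nsets {1..Suc M} k \<subseteq> drawn_edges (play (greedy_builder k) P i) \<union> nsets {} k"
proof (induction M)
  case 0
  have [simp]: "stage (play (greedy_builder k) P 0) = 1" by simp
  obtain j where j: "stage (play (greedy_builder k) P j) = 1"
    "missing_edges k (play (greedy_builder k) P j) = {}"
    using greedy_builder_completes_stage[of k P 0] by (auto simp del: play.simps)
  have "nsets {1..Suc 0} k \<subseteq> {e \<in> nsets {1..Suc 0} k. 1 \<in> e} \<union> nsets {} k"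
    by (auto simp: nsets_def)
  with j show ?case
    by (intro exI[of _ j]) (auto simp: missing_edges_def)
next
  case (Suc M)
  then obtain i where i: "stage (play (greedy_builder k) P i) = Suc M"
    "nsets {1..Suc M} k \<subseteq> drawn_edges (play (greedy_builder k) P i) \<union> nsets {} k"
    by blast
  obtain j where j: "stage (play (greedy_builder k) P j) = Suc M"
    "nsets {1..Suc M} k \<subseteq> drawn_edges (play (greedy_builder k) P j) \<union> nsets {} k"
    "missing_edges k (play (greedy_builder k) P j) = {}"
    using greedy_builder_completes_stage[of k P i] i by fastforce
  have next_play: "play (greedy_builder k) P (Suc j) = Vertex_Added # play (greedy_builder k) P j"
    using j(3) by (simp add: greedy_builder_def)
  obtain l where l: "stage (play (greedy_builder k) P l) = Suc (Suc M)"
    "drawn_edges (play (greedy_builder k) P j) \<subseteq> drawn_edges (play (greedy_builder k) P l)"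
    "missing_edges k (play (greedy_builder k) P l) = {}"
    using greedy_builder_completes_stage[of k P "Suc j"] j(1) unfolding next_play by auto
  have "nsets {1..Suc (Suc M)} k \<subseteq>
      {e \<in> nsets {1..Suc (Suc M)} k. Suc (Suc M) \<in> e} \<union> nsets {1..Suc M} k"
    by (auto simp: nsets_def subset_iff le_Suc_eq)
  also have "\<dots> \<subseteq> drawn_edges (play (greedy_builder k) P l) \<union> nsets {} k"
    using l j(2) by (auto simp: missing_edges_def)
  finally show ?case
    using l(1) by blast
qed

lemma monotone_path_in_clique:
  assumes H: "H \<in> nsets V n" and E: "nsets H k \<subseteq> E"
  shows "\<exists>a. monotone_path k n V E a"
proof (intro exI)
  \<comment> \<open>\<open>enumerate\<close> counts from 0, paths count from 1.\<close>
  let ?a = "\<lambda>i. enumerate H (i - 1)"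
  have fin: "finite H" "card H = n" "H \<subseteq> V"
    using H by (auto simp: nsets_def)
  have mono: "strict_mono_on {1..n} ?a"
    using fin by (auto simp: strict_mono_on_def intro!: finite_enumerate_mono)
  have mem: "?a i \<in> H" if "i \<in> {1..n}" for i
    using that fin by (auto intro!: finite_enumerate_in_set)
  have "?a ` {i..<i + k} \<in> nsets H k" if "i \<in> {1..n + 1 - k}" for i
  proof -
    have sub: "{i..<i + k} \<subseteq> {1..n}"
      using that by auto
    then have "card (?a ` {i..<i + k}) = k"
      using inj_on_subset[OF strict_mono_on_imp_inj_on[OF mono] sub] by (simp add: card_image)
    with mem sub show ?thesis
      unfolding nsets_def by blast
  qed
  with mono mem fin E show "monotone_path k n V E ?a"
    unfolding monotone_path_def by blast
qed

text \<open>Makes the LEAST in \<open>vertex_online_ramsey\<close> attained. On sufficiently many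
  vertices the complete hypergraph contains a monochromatic clique of size \<open>n\<close> by
  Ramsey's theorem, and listing it in increasing order gives the path.\<close>

lemma builder_wins:
  assumes "1 \<le> k"
  shows "\<exists>m. builder_wins_within k q n m"
proof -
  obtain M :: nat where "partn_lst {..<M} (replicate q n) k"
    using ramsey_full by blast
  \<comment> \<open>A play starts with one vertex already present, so the number of vertices must be
    positive; \<open>Suc M\<close> also covers \<open>M = 0\<close>.\<close>
  then have ramsey: "partn_lst {..<Suc M} (replicate q n) k"
    by (rule partn_lst_greater_resource) simp
  have "\<exists>i. has_mono_path k q n (play (greedy_builder k) P i) \<and>
      card (drawn_edges (play (greedy_builder k) P i)) \<le> card (nsets {1..Suc M} k)"
    if P: "legal_painter q P" for P
  proof -
    obtain i where i: "stage (play (greedy_builder k) P i) = Suc M"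
      "nsets {1..Suc M} k \<subseteq> drawn_edges (play (greedy_builder k) P i) \<union> nsets {} k"
      using greedy_builder_completes_graph by blast
    define h where "h = play (greedy_builder k) P i"
    have complete: "nsets {1..Suc M} k \<subseteq> drawn_edges h"
      using i(2) assms by (auto simp: h_def nsets_empty_iff)
    have colors: "c < q" if "Edge_Colored e c \<in> set h" for e c
      using that P unfolding h_def
      by (induction i) (auto simp: Let_def legal_painter_def split: builder_move.splits)
    \<comment> \<open>The vertices of the game start at 1, those in Ramsey's theorem at 0, so the
      played colors are pulled back along \<open>Suc\<close>.\<close>
    define g where "g e = (SOME c. Edge_Colored (Suc ` e) c \<in> set h)" for e
    have g: "Edge_Colored (Suc ` e) (g e) \<in> set h" if "e \<in> nsets {..<Suc M} k" for e
    proof -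
      have "Suc ` e \<in> nsets {1..Suc M} k"
        using that by (auto simp: nsets_def card_image)
      then show ?thesis
        using complete unfolding g_def by (meson drawn_edges_iff someI subsetD)
    qed
    then have "g \<in> nsets {..<Suc M} k \<rightarrow> {..<length (replicate q n)}"
      using colors by auto
    then obtain c H where c: "c < q" and H: "H \<in> nsets {..<Suc M} n" "g ` nsets H k \<subseteq> {c}"
      using partn_lstE[OF ramsey, of g q] by auto
    have "nsets (Suc ` H) k \<subseteq> edges_of_color h c"
    proof
      fix e assume "e \<in> nsets (Suc ` H) k"
      then obtain d where d: "d \<in> nsets H k" "e = Suc ` d"
        by (auto elim: nset_image_obtains)
      then have "g d = c" "d \<in> nsets {..<Suc M} k"
        using H by (auto simp: nsets_def)
      with g d show "e \<in> edges_of_color h c"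
        by (auto simp: edges_of_color_def)
    qed
    moreover have "Suc ` H \<in> nsets {1..stage h} n"
      using H(1) i(1) by (auto simp: nsets_def card_image h_def)
    ultimately have "has_mono_path k q n h"
      unfolding has_mono_path_def using c monotone_path_in_clique by blast
    moreover have "card (drawn_edges h) \<le> card (nsets {1..Suc M} k)"
      using well_formed_play[OF legal_greedy_builder, of k P i] i(1)
      by (intro card_mono finite_imp_finite_nsets) (simp_all add: well_formed_def h_def)
    ultimately show ?thesis
      unfolding h_def by blast
  qed
  then show ?thesis
    unfolding builder_wins_within_def using legal_greedy_builder by blast
qed

section \<open>The embedding painter\<close>

text \<open>Applied to the history just before an edge is drawn: a head \<open>Vertex_Added\<close>
  then means that this edge is the first of its stage. Stages without edges cost no element of the
  reserve.\<close>

definition settle :: "history \<Rightarrow> (nat \<Rightarrow> nat) \<times> nat set \<Rightarrow> (nat \<Rightarrow> nat) \<times> nat set" where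
  "settle h = (\<lambda>(f, S).
     if hd h = Vertex_Added then (f(stage h := Min S), S - {Min S}) else (f, S))"

definition select ::
    "(nat set \<Rightarrow> nat) \<Rightarrow> nat set \<Rightarrow> nat \<Rightarrow> (nat \<Rightarrow> nat) \<times> nat set \<Rightarrow> (nat \<Rightarrow> nat) \<times> nat set" where
  "select \<chi> e c = (\<lambda>(f, S). (f, {w \<in> S. \<chi> (insert w (f ` e)) = c}))"

text \<open>The pair of partial embedding and reserve; the embedding has the junk value \<open>0\<close> at vertices
  that are not \<^const>\<open>backed\<close>.\<close>

primrec embedding :: "(nat set \<Rightarrow> nat) \<Rightarrow> nat \<Rightarrow> history \<Rightarrow> (nat \<Rightarrow> nat) \<times> nat set" where
  "embedding \<chi> N [] = (\<lambda>_. 0, {1..N})"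
| "embedding \<chi> N (x # h) =
     (case x of
        Vertex_Added \<Rightarrow> embedding \<chi> N h
      | Edge_Colored e c \<Rightarrow> select \<chi> e c (settle h (embedding \<chi> N h)))"

text \<open>A painter sees only the history, so embedding and reserve are recomputed from
  it.\<close>

definition greedy_painter :: "(nat set \<Rightarrow> nat) \<Rightarrow> nat \<Rightarrow> nat \<Rightarrow> painter" where
  "greedy_painter \<chi> N q h e =
     arg_max (\<lambda>c. card (snd (select \<chi> e c (settle h (embedding \<chi> N h))))) (\<lambda>c. c < q)"

text \<open>\<open>R\<close> is the set of embedded vertices. It is a parameter because between
  \<open>settle\<close> and the coloring of the edge the newest vertex is embedded but perhaps not
  yet \<open>backed\<close>. The last clause says that the color of an edge predicts
  \<open>\<chi>\<close> on its image extended by any element of the reserve or by the image of any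
  later embedded vertex.\<close>

definition consistent ::
    "(nat set \<Rightarrow> nat) \<Rightarrow> nat \<Rightarrow> history \<Rightarrow> nat set \<Rightarrow> (nat \<Rightarrow> nat) \<times> nat set \<Rightarrow> bool" where
  "consistent \<chi> N h R = (\<lambda>(f, S).
     S \<subseteq> {1..N} \<and> f ` R \<subseteq> {1..N} \<and> strict_mono_on R f \<and> (\<forall>r\<in>R. \<forall>s\<in>S. f r < s) \<and>
     (\<forall>e c. Edge_Colored e c \<in> set h \<longrightarrow>
        (\<forall>w \<in> S \<union> f ` {r\<in>R. Max e < r}. \<chi> (insert w (f ` e)) = c)))"

section \<open>Pigeonhole for the painter's color choice\<close>

lemma greedy_painter_maximal:
  assumes "0 < q"
  shows "greedy_painter \<chi> N q h e < q"
    and "c < q \<Longrightarrow> card (snd (select \<chi> e c (settle h (embedding \<chi> N h)))) \<le>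
      card (snd (select \<chi> e (greedy_painter \<chi> N q h e) (settle h (embedding \<chi> N h))))"
proof -
  let ?F = "\<lambda>c. card (snd (select \<chi> e c (settle h (embedding \<chi> N h))))"
  have "\<forall>c. c < q \<longrightarrow> ?F c < Suc (Max (?F ` {..<q}))"
    by (auto simp: less_Suc_eq_le)
  then have "greedy_painter \<chi> N q h e < q \<and> (\<forall>c. c < q \<longrightarrow> ?F c \<le> ?F (greedy_painter \<chi> N q h e))"
    unfolding greedy_painter_def using assms by (intro arg_max_nat_lemma) auto
  then show "greedy_painter \<chi> N q h e < q"
    and "c < q \<Longrightarrow> ?F c \<le> ?F (greedy_painter \<chi> N q h e)" by auto
qed

lemma legal_greedy_painter: "0 < q \<Longrightarrow> legal_painter q (greedy_painter \<chi> N q)"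
  by (simp add: legal_painter_def greedy_painter_maximal)

text \<open>The \<open>q\<close> color classes cover the reserve.\<close>

lemma card_le_select:
  assumes "finite (snd fS)" and "\<And>s. \<chi> s < q"
    and "\<And>c. c < q \<Longrightarrow> card (snd (select \<chi> e c fS)) \<le> m"
  shows "card (snd fS) \<le> q * m"
proof -
  have "snd fS \<subseteq> (\<Union>c<q. snd (select \<chi> e c fS))"
    using assms(2) by (auto simp: select_def case_prod_beta)
  then have "card (snd fS) \<le> card (\<Union>c<q. snd (select \<chi> e c fS))"
    using assms(1) by (intro card_mono) (auto simp: select_def case_prod_beta)
  also have "\<dots> \<le> (\<Sum>c<q. card (snd (select \<chi> e c fS)))"
    by (rule card_UN_le) simp
  also have "\<dots> \<le> of_nat (card {..<q}) * m"
    using assms(3) by (intro sum_bounded_above) auto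
  finally show ?thesis by simp
qed

lemma card_le_settle: "card (snd fS) \<le> Suc (card (snd (settle h fS)))"
  by (auto simp: settle_def card_Diff_singleton_if case_prod_beta)

section \<open>Preservation of the invariant\<close>

text \<open>The minimum of the reserve lies above all earlier images and below the remaining
  reserve. The color clause already covered it as an element of the reserve.\<close>

lemma consistent_settle:
  assumes wf: "well_formed k h" and "0 < k"
    and con: "consistent \<chi> N h (backed h) fS" and ne: "snd fS \<noteq> {}"
  shows "consistent \<chi> N h (insert (stage h) (backed h)) (settle h fS)"
proof (cases "hd h = Vertex_Added")
  case False
  then show ?thesis
    using wf con by (auto simp: well_formed_def settle_def insert_absorb)
next
  case True
  obtain f S where fS: "fS = (f, S)" by fastforce
  let ?t = "stage h" and ?v = "Min S"
  let ?f = "f(?t := ?v)"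
  have S: "S \<subseteq> {1..N}" "finite S" and fR: "f ` backed h \<subseteq> {1..N}" "strict_mono_on (backed h) f"
    and below: "\<And>r s. r \<in> backed h \<Longrightarrow> s \<in> S \<Longrightarrow> f r < s"
    and col: "\<And>e c w. Edge_Colored e c \<in> set h \<Longrightarrow> w \<in> S \<union> f ` {r\<in>backed h. Max e < r} \<Longrightarrow>
      \<chi> (insert w (f ` e)) = c"
    using con by (auto simp: consistent_def fS intro: finite_subset)
  have v: "?v \<in> S" "\<And>s. s \<in> S - {?v} \<Longrightarrow> ?v < s"
    using S(2) ne fS by (auto simp: order.strict_iff_order)
  have old: "e \<subseteq> {1..<?t}" "finite e" "e \<noteq> {}" if "e \<in> drawn_edges h" for e
    using wf True that \<open>0 < k\<close> by (auto simp: well_formed_def nsets_def)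
  have R: "r < ?t" if "r \<in> backed h" for r
    using that old Max_in by (fastforce simp: backed_def)
  \<comment> \<open>No old edge contains the newest vertex, so redefining \<open>f\<close> there
    changes no image of an edge.\<close>
  have same: "?f ` e = f ` e" if "e \<in> drawn_edges h" for e
    using old(1)[OF that] by (intro image_cong) auto
  have sameR: "?f r = f r" if "r \<in> backed h" for r
    using R[OF that] by simp
  have "strict_mono_on (insert ?t (backed h)) ?f"
    using fR(2) R below v(1) by (auto simp: strict_mono_on_def dest: less_asym)
  moreover have "\<chi> (insert w (?f ` e)) = c"
    if e: "Edge_Colored e c \<in> set h"
      and w: "w \<in> (S - {?v}) \<union> ?f ` {r\<in>insert ?t (backed h). Max e < r}" for e c w
  proof -
    have "w \<in> S \<union> f ` {r\<in>backed h. Max e < r}"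
      using w v(1) sameR by auto
    moreover have "?f ` e = f ` e"
      using e by (intro same) (auto simp: drawn_edges_iff)
    ultimately show ?thesis
      using col[OF e] by simp
  qed
  moreover have "?f ` insert ?t (backed h) \<subseteq> {1..N}"
    using fR(1) S(1) v(1) sameR by auto
  moreover have "?f r < s" if "r \<in> insert ?t (backed h)" "s \<in> S - {?v}" for r s
    using that v(2) below sameR by auto
  ultimately show ?thesis
    using S(1) True by (auto simp: consistent_def settle_def fS simp del: fun_upd_apply)
qed

text \<open>No embedded vertex lies beyond the new edge, so its color clause concerns only the
  reserve, where \<open>select\<close> enforces it. Older clauses survive because the reserve only
  shrinks.\<close>

lemma consistent_select:
  assumes "consistent \<chi> N h R fS" and "\<And>r. r \<in> R \<Longrightarrow> r \<le> Max e"
  shows "consistent \<chi> N (Edge_Colored e c # h) R (select \<chi> e c fS)"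
proof -
  have "{r \<in> R. Max e < r} = {}"
    using assms(2) by (auto simp: not_less)
  then show ?thesis
    using assms(1) by (auto simp: consistent_def select_def case_prod_beta)
qed

lemma painter_invariant:
  assumes B: "legal_builder k B" and "0 < k" and "2 \<le> q" and \<chi>: "\<And>s. \<chi> s < q" and N: "q ^ V \<le> N"
    and "card (drawn_edges (play B (greedy_painter \<chi> N q) i)) \<le> V"
  defines "h \<equiv> play B (greedy_painter \<chi> N q) i"
  shows "consistent \<chi> N h (backed h) (embedding \<chi> N h) \<and>
    q ^ (V - card (drawn_edges h)) \<le> card (snd (embedding \<chi> N h))"
  using assms(6) unfolding h_def
proof (induction i)
  case 0
  show ?case
    using N by (simp add: consistent_def backed_def)
next
  case (Suc i)
  define h where "h = play B (greedy_painter \<chi> N q) i"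
  show ?case
  proof (cases "B h")
    case Next_Stage
    then have "play B (greedy_painter \<chi> N q) (Suc i) = Vertex_Added # h"
      by (simp add: h_def)
    then show ?thesis
      using Suc by (simp add: consistent_def backed_def h_def)
  next
    case (Draw e)
    define c where "c = greedy_painter \<chi> N q h e"
    define d where "d = card (drawn_edges h)"
    define T where "T = settle h (embedding \<chi> N h)"
    have h': "play B (greedy_painter \<chi> N q) (Suc i) = Edge_Colored e c # h"
      using Draw by (simp add: h_def c_def Let_def)
    have e: "e \<in> nsets {1..stage h} k" "stage h \<in> e" "e \<notin> drawn_edges h"
      using B Draw by (auto simp: legal_builder_def)
    have wf: "well_formed k h"
      unfolding h_def using B by (rule well_formed_play)
    \<comment> \<open>The edge is new, so the induction hypothesis applies and \<open>V - d\<close>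
      is positive.\<close>
    have d: "Suc d \<le> V"
      using Suc.prems e(3) unfolding h' by (simp add: d_def)
    then have con: "consistent \<chi> N h (backed h) (embedding \<chi> N h)"
      and large: "q ^ (V - d) \<le> card (snd (embedding \<chi> N h))"
      using Suc.IH by (simp_all add: h_def d_def)
    have "0 < q ^ (V - d)"
      using \<open>2 \<le> q\<close> by simp
    with large have "snd (embedding \<chi> N h) \<noteq> {}"
      by auto
    then have conT: "consistent \<chi> N h (insert (stage h) (backed h)) T"
      unfolding T_def by (rule consistent_settle[OF wf \<open>0 < k\<close> con])
    have R: "r \<le> Max e" if "r \<in> insert (stage h) (backed h)" for r
    proof -
      have "finite e'" "e' \<noteq> {}" "e' \<subseteq> {1..stage h}" if "e' \<in> drawn_edges h" for e'
        using wf that \<open>0 < k\<close> by (auto simp: well_formed_def nsets_def)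
      then have "Max e' \<le> stage h" if "e' \<in> drawn_edges h" for e'
        using that Max_in by (meson atLeastAtMost_iff subsetD)
      then show ?thesis
        using that Max_edge[OF e(1,2)] by (auto simp: backed_def)
    qed
    have "consistent \<chi> N (Edge_Colored e c # h) (insert (stage h) (backed h)) (select \<chi> e c T)"
      using conT R by (rule consistent_select)
    then have con': "consistent \<chi> N (Edge_Colored e c # h) (backed (Edge_Colored e c # h))
        (embedding \<chi> N (Edge_Colored e c # h))"
      using Max_edge[OF e(1,2)] by (simp add: backed_def T_def)
    have "finite (snd T)"
      using conT by (auto simp: consistent_def intro: finite_subset split: prod.splits)
    then have "card (snd T) \<le> q * card (snd (select \<chi> e c T))"
      using \<chi> greedy_painter_maximal(2)[of q] \<open>2 \<le> q\<close>
      by (intro card_le_select) (auto simp: c_def T_def)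
    moreover have "card (snd (embedding \<chi> N h)) \<le> Suc (card (snd T))"
      unfolding T_def by (rule card_le_settle)
    moreover have "q ^ (V - d) = q * q ^ (V - Suc d)"
      using d by (metis Suc_diff_Suc Suc_le_lessD power_Suc)
    \<comment> \<open>The \<open>+ 1\<close> pays for a vertex that may have been placed. As
      \<open>2 \<le> q\<close>, it is lost in the division by \<open>q\<close>.\<close>
    ultimately have "q * q ^ (V - Suc d) \<le> q * card (snd (select \<chi> e c T)) + 1"
      using large by linarith
    also have "\<dots> < q * Suc (card (snd (select \<chi> e c T)))"
      using \<open>2 \<le> q\<close> by simp
    finally have "q ^ (V - Suc d) \<le> card (snd (select \<chi> e c T))"
      by (simp only: mult_less_cancel1 less_Suc_eq_le)
    then show ?thesis
      unfolding h' using con' e(3) by (simp add: d_def T_def)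
  qed
qed

section \<open>Lifting paths\<close>

text \<open>\<open>a (i + k)\<close> is the last vertex of the \<open>i\<close>-th edge of the path,
  hence embedded. Of \<open>k + 2\<close> consecutive such vertices the first \<open>k + 1\<close>
  form an edge of color \<open>c\<close>, and the last is a later embedded vertex, so the color
  clause of \<open>consistent\<close> gives the value of \<open>\<chi>\<close>.\<close>

lemma lift_monotone_path:
  assumes con: "consistent \<chi> N h (backed h) (f, S)"
    and path: "monotone_path (Suc k) (n + k) {1..stage h} (edges_of_color h c) a"
  shows "monotone_path (Suc (Suc k)) n {1..N} {e \<in> nsets {1..N} (Suc (Suc k)). \<chi> e = c}
    (\<lambda>i. f (a (i + k)))"
proof -
  let ?b = "\<lambda>i. f (a (i + k))"
  have mono: "strict_mono_on {1..n + k} a"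
    and edge: "\<And>i. i \<in> {1..n} \<Longrightarrow> a ` {i..<i + Suc k} \<in> edges_of_color h c"
    using path by (auto simp: monotone_path_def)
  have Max_a: "Max (a ` {i..<i + Suc k}) = a (i + k)" if "i \<in> {1..n}" for i
  proof (rule Max_eqI)
    fix y assume "y \<in> a ` {i..<i + Suc k}"
    then obtain j where j: "y = a j" "i \<le> j" "j \<le> i + k" by auto
    then show "y \<le> a (i + k)"
      using that strict_mono_onD[OF mono, of j "i + k"] by (cases "j = i + k") auto
  qed auto
  have backed: "a (i + k) \<in> backed h" if "i \<in> {1..n}" for i
    unfolding backed_def Max_a[OF that, symmetric] using edge[OF that]
    by (auto simp: drawn_edges_def)
  have mono_b: "strict_mono_on {1..n} ?b"
    using con backed mono by (auto simp: consistent_def strict_mono_on_def)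
  have in_N: "?b i \<in> {1..N}" if "i \<in> {1..n}" for i
    using con backed[OF that] by (auto simp: consistent_def)
  have "?b ` {i..<i + Suc (Suc k)} \<in> {e \<in> nsets {1..N} (Suc (Suc k)). \<chi> e = c}"
    if i: "i \<in> {1..n + 1 - Suc (Suc k)}" for i
  proof -
    let ?I = "{i..<i + Suc (Suc k)}"
    have I: "?I \<subseteq> {1..n}" using i by auto
    have "card (?b ` ?I) = Suc (Suc k)"
      using inj_on_subset[OF strict_mono_on_imp_inj_on[OF mono_b] I] by (simp add: card_image)
    moreover have "?b ` ?I \<subseteq> {1..N}"
      using in_N I by blast
    moreover have "\<chi> (?b ` ?I) = c"
    proof -
      \<comment> \<open>The edge of \<open>a\<close> with index \<open>i + k\<close>, whose image
        consists of the first \<open>k + 1\<close> vertices of the window of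
        \<open>?b\<close>.\<close>
      let ?e = "a ` {i + k..<i + k + Suc k}"
      have ik: "i + k \<in> {1..n}" "i + Suc k \<in> {1..n}" using i by auto
      have "a (i + k + k) < a (i + Suc k + k)"
        using ik by (intro strict_mono_onD[OF mono]) auto
      then have "Max ?e < a (i + Suc k + k)"
        using Max_a[OF ik(1)] by simp
      then have "\<chi> (insert (?b (i + Suc k)) (f ` ?e)) = c"
        using con edge[OF ik(1)] backed[OF ik(2)]
        by (auto simp: consistent_def edges_of_color_def)
      moreover have "?b ` ?I = insert (?b (i + Suc k)) (f ` ?e)"
      proof -
        have "?I = insert (i + Suc k) {i..<i + Suc k}" by auto
        moreover have "{i + k..<i + k + Suc k} = (\<lambda>j. j + k) ` {i..<i + Suc k}"
          by (simp add: add.commute add.left_commute)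
        ultimately show ?thesis
          by (simp only: image_insert image_image)
      qed
      ultimately show ?thesis by simp
    qed
    ultimately show ?thesis
      by (simp add: nsets_def)
  qed
  with mono_b in_N show ?thesis
    unfolding monotone_path_def by blast
qed

section \<open>Optimal builder against embedding painter\<close>

theorem theorem4:
  fixes k q n :: nat
  assumes "k \<ge> 3" and "q \<ge> 2" and "n \<ge> k"
  shows "path_ramsey k q n \<le> q ^ vertex_online_ramsey (k - 1) q (n + k - 2) + (k - 2)"
proof -
  define l where "l = k - 2"
  with assms(1) have k: "k = Suc (Suc l)" by simp
  define V where "V = vertex_online_ramsey (k - 1) q (n + k - 2)"
  define N where "N = q ^ V + (k - 2)"
  have "builder_wins_within (k - 1) q (n + k - 2) V"
    unfolding V_def vertex_online_ramsey_def
    using builder_wins[of "k - 1" q "n + k - 2"] k by (auto intro: LeastI_ex)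
  then obtain B where B: "legal_builder (Suc l) B"
    and win: "\<And>P. legal_painter q P \<Longrightarrow> \<exists>i. has_mono_path (Suc l) q (n + l) (play B P i) \<and>
      card (drawn_edges (play B P i)) \<le> V"
    unfolding builder_wins_within_def k by auto
  have "\<exists>c<q. \<exists>a. monotone_path k n {1..N} {e \<in> nsets {1..N} k. \<chi> e = c} a"
    if \<chi>: "\<chi> \<in> nsets {1..N} k \<rightarrow> {..<q}" for \<chi>
  proof -
    \<comment> \<open>An edge may contain vertices that are not \<open>backed\<close>, with junk
      image 0, so the painter also evaluates the coloring outside \<open>nsets {1..N} k\<close>;
      \<open>mod q\<close> keeps its values below \<open>q\<close> there.\<close>
    define \<chi>' where "\<chi>' e = \<chi> e mod q" for e
    have same: "\<chi>' e = \<chi> e" if "e \<in> nsets {1..N} k" for e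
      using funcset_mem[OF \<chi> that] by (simp add: \<chi>'_def)
    define P where "P = greedy_painter \<chi>' N q"
    obtain i where i: "has_mono_path (Suc l) q (n + l) (play B P i)"
      "card (drawn_edges (play B P i)) \<le> V"
      using win[of P] legal_greedy_painter assms(2) by (auto simp: P_def)
    define h where "h = play B P i"
    obtain c a where c: "c < q"
      and a: "monotone_path (Suc l) (n + l) {1..stage h} (edges_of_color h c) a"
      using i(1) by (auto simp: has_mono_path_def h_def)
    obtain f S where fS: "embedding \<chi>' N h = (f, S)" by fastforce
    have "consistent \<chi>' N h (backed h) (embedding \<chi>' N h)"
      unfolding h_def P_def
      by (rule painter_invariant[THEN conjunct1, OF B])
         (use assms(2) i(2) in \<open>auto simp: \<chi>'_def N_def P_def\<close>)
    with a have "monotone_path k n {1..N} {e \<in> nsets {1..N} k. \<chi>' e = c} (\<lambda>i. f (a (i + l)))"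
      unfolding fS k by (intro lift_monotone_path)
    moreover have "{e \<in> nsets {1..N} k. \<chi>' e = c} = {e \<in> nsets {1..N} k. \<chi> e = c}"
      using same by auto
    ultimately show ?thesis
      using c by auto
  qed
  then show ?thesis
    unfolding path_ramsey_def V_def[symmetric] N_def[symmetric] by (intro Least_le ballI)
qed

end
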